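(* Let $(W^*,X^*,U^*,V^* )\in\mathcal{M}$ be an integer master problem solution, let $k\in N$ and $t\in T$, assume that $W^*_{kt}=0$ (the facility at the source node $k$ is closed at time $t$), and assume that the sub-problem $\mathrm{SP}_{kt}(W^*,X^* )$ is feasible. For $i\in N$ let $D_i\in[0,\infty]$ be the length of a shortest directed path from $k$ to $i$, with arc lengths $\rho_{ijt}$, in the network consisting of the open arcs $\{(i,j)\in A: X^*_{ijt}=1\}$ (with $D_k=0$, and $D_i=\infty$ if there is no such path). Define $$\gamma_k=\min\{D_j : j\in N\setminus\{k\},\ W^*_{jt}=1\},\qquad \gamma_i=\max(0,\gamma_k-D_i)\quad (i\in N\setminus\{k\}),$$ and, for $(i,j)\in A$, $$\lambda_{ij}=\begin{cases}\max(0,\gamma_i-\gamma_j-\rho_{ijt}) & \text{if } X^*_{ijt}=0,\\ 0 & \text{if } X^*_{ijt}=1.\end{cases}$$ Then $(\gamma,\lambda)$ is an optimal solution of the dual linear program $\mathrm{D}_{kt}(W^*,X^* )$.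
   Context: Setting (dynamic uncapacitated facility location and network design). $N$ is a finite set of nodes (each is a client and a potential facility site), $A\subseteq N\times N$ is a set of arcs such that $(j,i)\in A$ whenever $(i,j)\in A$, and $T=\{1,\dots,|T|\}$ is the set of time periods. Data, all nonnegative reals: $\rho_{ijt}$ (unit routing cost on arc $(i,j)$ at time $t$), $g_{it}$ (cost of opening facility $i$), $c_{ijt}$ (cost of constructing arc $(i,j)$), $\bar B_t,\hat B_t$ (budgets for facilities and arcs). The initial network is given by fixed binary values $W_{i0}$, $X_{ij0}$. Integer master solutions. $\mathcal{M}$ is the set of binary vectors $(W,X,U,V)$ (with $W_{it},U_{it}$ indexed by $i\in N,t\in T$ and $X_{ijt},V_{ijt}$ indexed by $(i,j)\in A,t\in T$) satisfying $W_{i,t-1}+U_{it}=W_{it}$ for all $i,t$; $X_{ij,t-1}+V_{ijt}=X_{ijt}$ for all $(i,j)\in A$, $t$; $\sum_{t'=1}^t\sum_{i\in N}g_{it'}U_{it'}\le\sum_{t'=1}^t\bar B_{t'}$ for all $t$; $\sum_{t'=1}^t\sum_{(i,j)\in A}c_{ijt'}V_{ijt'}\le\sum_{t'=1}^t\hat B_{t'}$ for all $t$; and $X_{ijt}=X_{jit}$ for all $(i,j)\in A$, $t$. Here $W_{it}=1$ means facility $i$ is open at time $t$, and $X_{ijt}=1$ means arc $(i,j)$ is open at time $t$. Sub-problem $\mathrm{SP}_{kt}(W^*,X^* )$: minimise $\sum_{(i,j)\in A}\rho_{ijt}Z_{ij}$ over $Z\in\mathbb{R}^A_{\ge0}$ subject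 to $-\sum_{j:(k,j)\in A}Z_{kj}\le W^*_{kt}-1$; $\sum_{j:(j,i)\in A}Z_{ji}-\sum_{j:(i,j)\in A}Z_{ij}\le W^*_{it}$ for all $i\in N\setminus\{k\}$; $Z_{jk}=0$ for all $(j,k)\in A$; $Z_{ij}\le X^*_{ijt}$ for all $(i,j)\in A$. Dual $\mathrm{D}_{kt}(W^*,X^* )$: maximise $\gamma_k-\sum_{i\in N}\gamma_iW^*_{it}-\sum_{(i,j)\in A}\lambda_{ij}X^*_{ijt}$ over $\gamma\in\mathbb{R}^N_{\ge0}$, $\lambda\in\mathbb{R}^A_{\ge0}$ subject to $\rho_{ijt}+\lambda_{ij}+\gamma_j-\gamma_i\ge0$ for all $(i,j)\in A$ with $j\ne k$. *)

theory Defs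
  imports Complex_Main "Graph_Theory.Shortest_Path" "Graph_Theory.Pair_Digraph"
begin

text \<open>
  Nodes are the elements of \<open>N\<close>, arcs are pairs in \<open>A\<close>, and the time periods are
  \<open>{1..n}\<close>. Vectors are total functions; only their values on the index sets
  matter. Period 0 of \<open>W\<close> and \<open>X\<close> is not a decision: it carries the initial
  network \<open>W0\<close>, \<open>X0\<close>, so that the linking equations need no case
  distinction at the first period.
\<close>

definition master_solution ::
  "'a set \<Rightarrow> ('a \<times> 'a) set \<Rightarrow> nat \<Rightarrow> ('a \<Rightarrow> nat \<Rightarrow> real) \<Rightarrow> ('a \<times> 'a \<Rightarrow> nat \<Rightarrow> real)
    \<Rightarrow> (nat \<Rightarrow> real) \<Rightarrow> (nat \<Rightarrow> real) \<Rightarrow> ('a \<Rightarrow> real) \<Rightarrow> ('a \<times> 'a \<Rightarrow> real)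
    \<Rightarrow> ('a \<Rightarrow> nat \<Rightarrow> real) \<Rightarrow> ('a \<times> 'a \<Rightarrow> nat \<Rightarrow> real)
    \<Rightarrow> ('a \<Rightarrow> nat \<Rightarrow> real) \<Rightarrow> ('a \<times> 'a \<Rightarrow> nat \<Rightarrow> real) \<Rightarrow> bool" where
  "master_solution N A n g c Bfac Barc W0 X0 W X U V \<longleftrightarrow>
     (\<forall>i\<in>N. \<forall>t\<in>{1..n}. W i t \<in> {0, 1} \<and> U i t \<in> {0, 1}) \<and>
     (\<forall>e\<in>A. \<forall>t\<in>{1..n}. X e t \<in> {0, 1} \<and> V e t \<in> {0, 1}) \<and>
     (\<forall>i\<in>N. W i 0 = W0 i) \<and>
     (\<forall>e\<in>A. X e 0 = X0 e) \<and>
     (\<forall>i\<in>N. \<forall>t\<in>{1..n}. W i (t - 1) + U i t = W i t) \<and>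
     (\<forall>e\<in>A. \<forall>t\<in>{1..n}. X e (t - 1) + V e t = X e t) \<and>
     (\<forall>t\<in>{1..n}. (\<Sum>t'=1..t. \<Sum>i\<in>N. g i t' * U i t') \<le> (\<Sum>t'=1..t. Bfac t')) \<and>
     (\<forall>t\<in>{1..n}. (\<Sum>t'=1..t. \<Sum>e\<in>A. c e t' * V e t') \<le> (\<Sum>t'=1..t. Barc t')) \<and>
     (\<forall>(i, j)\<in>A. \<forall>t\<in>{1..n}. X (i, j) t = X (j, i) t)"

definition SP_feasible ::
  "'a set \<Rightarrow> ('a \<times> 'a) set \<Rightarrow> 'a \<Rightarrow> nat \<Rightarrow> ('a \<Rightarrow> nat \<Rightarrow> real) \<Rightarrow> ('a \<times> 'a \<Rightarrow> nat \<Rightarrow> real)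
    \<Rightarrow> ('a \<times> 'a \<Rightarrow> real) \<Rightarrow> bool" where
  "SP_feasible N A k t W X Z \<longleftrightarrow>
     (\<forall>e\<in>A. 0 \<le> Z e) \<and>
     - (\<Sum>j | (k, j) \<in> A. Z (k, j)) \<le> W k t - 1 \<and>
     (\<forall>i\<in>N - {k}. (\<Sum>j | (j, i) \<in> A. Z (j, i)) - (\<Sum>j | (i, j) \<in> A. Z (i, j)) \<le> W i t) \<and>
     (\<forall>j. (j, k) \<in> A \<longrightarrow> Z (j, k) = 0) \<and>
     (\<forall>e\<in>A. Z e \<le> X e t)"

definition dual_feasible ::
  "'a set \<Rightarrow> ('a \<times> 'a) set \<Rightarrow> ('a \<times> 'a \<Rightarrow> nat \<Rightarrow> real) \<Rightarrow> 'a \<Rightarrow> nat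
    \<Rightarrow> ('a \<Rightarrow> real) \<Rightarrow> ('a \<times> 'a \<Rightarrow> real) \<Rightarrow> bool" where
  "dual_feasible N A \<rho> k t \<gamma> l \<longleftrightarrow>
     (\<forall>i\<in>N. 0 \<le> \<gamma> i) \<and>
     (\<forall>e\<in>A. 0 \<le> l e) \<and>
     (\<forall>(i, j)\<in>A. j \<noteq> k \<longrightarrow> \<rho> (i, j) t + l (i, j) + \<gamma> j - \<gamma> i \<ge> 0)"

definition dual_objective ::
  "'a set \<Rightarrow> ('a \<times> 'a) set \<Rightarrow> 'a \<Rightarrow> nat \<Rightarrow> ('a \<Rightarrow> nat \<Rightarrow> real) \<Rightarrow> ('a \<times> 'a \<Rightarrow> nat \<Rightarrow> real)
    \<Rightarrow> ('a \<Rightarrow> real) \<Rightarrow> ('a \<times> 'a \<Rightarrow> real) \<Rightarrow> real" where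
  "dual_objective N A k t W X \<gamma> l = \<gamma> k - (\<Sum>i\<in>N. \<gamma> i * W i t) - (\<Sum>e\<in>A. l e * X e t)"

definition dual_optimal ::
  "'a set \<Rightarrow> ('a \<times> 'a) set \<Rightarrow> ('a \<times> 'a \<Rightarrow> nat \<Rightarrow> real) \<Rightarrow> 'a \<Rightarrow> nat
    \<Rightarrow> ('a \<Rightarrow> nat \<Rightarrow> real) \<Rightarrow> ('a \<times> 'a \<Rightarrow> nat \<Rightarrow> real)
    \<Rightarrow> ('a \<Rightarrow> real) \<Rightarrow> ('a \<times> 'a \<Rightarrow> real) \<Rightarrow> bool" where
  "dual_optimal N A \<rho> k t W X \<gamma> l \<longleftrightarrow>
     dual_feasible N A \<rho> k t \<gamma> l \<and>
     (\<forall>\<gamma>' l'. dual_feasible N A \<rho> k t \<gamma>' l' \<longrightarrow>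
        dual_objective N A k t W X \<gamma>' l' \<le> dual_objective N A k t W X \<gamma> l)"

definition open_network ::
  "'a set \<Rightarrow> ('a \<times> 'a) set \<Rightarrow> nat \<Rightarrow> ('a \<times> 'a \<Rightarrow> nat \<Rightarrow> real) \<Rightarrow> ('a, 'a \<times> 'a) pre_digraph" where
  "open_network N A t X = with_proj \<lparr> pverts = N, parcs = {e \<in> A. X e t = 1} \<rparr>"

text \<open>
  \<open>wf_digraph.\<mu>\<close> is the infimum of the walk lengths, and is \<open>\<infinity>\<close> if there is no
  walk. As the arc lengths are nonnegative and the network is finite, the
  infimum is attained by a path whenever it is finite.
\<close>

definition source_dist ::
  "'a set \<Rightarrow> ('a \<times> 'a) set \<Rightarrow> ('a \<times> 'a \<Rightarrow> nat \<Rightarrow> real) \<Rightarrow> 'a \<Rightarrow> nat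
    \<Rightarrow> ('a \<times> 'a \<Rightarrow> nat \<Rightarrow> real) \<Rightarrow> 'a \<Rightarrow> ereal" where
  "source_dist N A \<rho> k t X i = wf_digraph.\<mu> (open_network N A t X) (\<lambda>e. \<rho> e t) k i"

text \<open>
  The infimum ranges over a finite set, hence is a minimum when that set is
  nonempty; over the empty set it is \<open>\<infinity>\<close>. The values are kept in the extended
  reals so that finiteness of \<open>\<gamma>\<close> can be stated.
\<close>

definition gamma_source ::
  "'a set \<Rightarrow> ('a \<times> 'a) set \<Rightarrow> ('a \<times> 'a \<Rightarrow> nat \<Rightarrow> real) \<Rightarrow> 'a \<Rightarrow> nat
    \<Rightarrow> ('a \<Rightarrow> nat \<Rightarrow> real) \<Rightarrow> ('a \<times> 'a \<Rightarrow> nat \<Rightarrow> real) \<Rightarrow> ereal" where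
  "gamma_source N A \<rho> k t W X = (INF j\<in>{j \<in> N - {k}. W j t = 1}. source_dist N A \<rho> k t X j)"

definition gamma_dist ::
  "'a set \<Rightarrow> ('a \<times> 'a) set \<Rightarrow> ('a \<times> 'a \<Rightarrow> nat \<Rightarrow> real) \<Rightarrow> 'a \<Rightarrow> nat
    \<Rightarrow> ('a \<Rightarrow> nat \<Rightarrow> real) \<Rightarrow> ('a \<times> 'a \<Rightarrow> nat \<Rightarrow> real) \<Rightarrow> 'a \<Rightarrow> ereal" where
  "gamma_dist N A \<rho> k t W X i =
     (if i = k then gamma_source N A \<rho> k t W X
      else max 0 (gamma_source N A \<rho> k t W X - source_dist N A \<rho> k t X i))"

definition lambda_dist ::
  "('a \<times> 'a \<Rightarrow> nat \<Rightarrow> real) \<Rightarrow> nat \<Rightarrow> ('a \<times> 'a \<Rightarrow> nat \<Rightarrow> real) \<Rightarrow> ('a \<Rightarrow> real)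
    \<Rightarrow> 'a \<times> 'a \<Rightarrow> real" where
  "lambda_dist \<rho> t X \<gamma> e =
     (if X e t = 0 then max 0 (\<gamma> (fst e) - \<gamma> (snd e) - \<rho> e t) else 0)"

end

theory Submission
  imports Defs
begin

text \<open>
  Let \<open>j\<close> be an open facility nearest to \<open>k\<close> in the network of open arcs. If \<open>(\<gamma>', l')\<close> is
  dual feasible, then summing the dual constraints along a simple path from \<open>k\<close> to \<open>j\<close> bounds its
  objective value by the length of the path; simplicity matters because arcs into \<open>k\<close> carry no
  constraint and because every \<open>l' e\<close> must be counted only once. The proposed vector is dual feasible
  by the triangle inequality for distances, and complementary slackness makes its objective value
  equal to the distance of \<open>j\<close>. Finiteness comes from flow conservation on the set of nodes
  reachable from \<open>k\<close>: the unit leaving \<open>k\<close> cannot cross open arcs out of this set.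
\<close>

text \<open>Potential differences telescope along the walk. The \<open>l\<close> part is kept apart
  from the cost because it is later compared with a sum over all arcs.\<close>

lemma (in wf_digraph) potential_drop_le_awalk_cost:
  assumes "awalk u p v"
    and "\<And>e. e \<in> set p \<Longrightarrow> y (tail G e) - y (head G e) \<le> c e + l e"
  shows "y u - y v \<le> awalk_cost c p + sum_list (map l p)"
  using assms
proof (induction p arbitrary: u)
  case Nil
  then show ?case by (simp add: awalk_Nil_iff)
next
  case (Cons e p)
  have "y (head G e) - y v \<le> awalk_cost c p + sum_list (map l p)"
    using Cons by (simp add: awalk_Cons_iff)
  moreover have "y u - y (head G e) \<le> c e + l e"
    using Cons.prems by (auto simp: awalk_Cons_iff)
  ultimately show ?case by simp
qed

text \<open>The heads of the arcs are exactly the vertices after the first one, and a path repeats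
  no vertex.\<close>

lemma (in wf_digraph) apath_head_neq_start:
  assumes "apath u p v" "e \<in> set p"
  shows "head G e \<noteq> u"
proof -
  from assms have "p \<noteq> []" and w: "awalk u p v" and d: "distinct (awalk_verts u p)"
    by (auto simp: apath_def)
  then have "awalk_verts u p = tail G (hd p) # map (head G) p"
    by (auto simp: awalk_verts_conv' awalk_def)
  moreover have "tail G (hd p) = u"
    using w \<open>p \<noteq> []\<close> by (cases p) (auto simp: awalk_Cons_iff)
  ultimately have "u \<notin> set (map (head G) p)"
    using d by simp
  then show ?thesis using assms(2) by auto
qed

lemma (in wf_digraph) mu_nonneg:
  assumes "\<And>e. e \<in> arcs G \<Longrightarrow> 0 \<le> c e"
  shows "0 \<le> \<mu> c u v"
  unfolding \<mu>_def using assms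
  by (auto intro!: INF_greatest pos_cost_pos_awalk_cost)

lemma (in wf_digraph) mu_self:
  assumes "\<And>e. e \<in> arcs G \<Longrightarrow> 0 \<le> c e" "u \<in> verts G"
  shows "\<mu> c u u = 0"
proof (rule antisym)
  have "\<mu> c u u \<le> awalk_cost c []"
    using assms(2) by (intro min_cost_le_walk_cost) (simp add: awalk_Nil_iff)
  then show "\<mu> c u u \<le> 0" by (simp add: zero_ereal_def)
qed (use assms mu_nonneg in blast)

lemma open_network_simps [simp]:
  "verts (open_network N A t X) = N"
  "arcs (open_network N A t X) = {e \<in> A. X e t = 1}"
  "tail (open_network N A t X) = fst"
  "head (open_network N A t X) = snd"
  by (simp_all add: open_network_def)

lemma fin_digraph_open_network:
  assumes "finite N" "A \<subseteq> N \<times> N"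
  shows "fin_digraph (open_network N A t X)"
proof -
  have "finite A" using assms finite_subset by blast
  then show ?thesis using assms by unfold_locales auto
qed

lemma sum_inflow_eq:
  fixes Z :: "'a \<times> 'a \<Rightarrow> real"
  assumes "finite A" "finite R"
  shows "(\<Sum>i\<in>R. \<Sum>j | (j, i) \<in> A. Z (j, i)) = (\<Sum>e | e \<in> A \<and> snd e \<in> R. Z e)"
proof -
  have "(\<Sum>j | (j, i) \<in> A. Z (j, i)) = (\<Sum>e | e \<in> A \<and> snd e = i. Z e)" for i
    by (rule sum.reindex_bij_witness[where i = fst and j = "\<lambda>j. (j, i)"]) auto
  moreover have "(\<Sum>i\<in>R. \<Sum>e | e \<in> {e \<in> A. snd e \<in> R} \<and> snd e = i. Z e)
      = (\<Sum>e | e \<in> A \<and> snd e \<in> R. Z e)"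
    using assms by (intro sum.group) auto
  moreover have "{e \<in> {e \<in> A. snd e \<in> R}. snd e = i} = {e. e \<in> A \<and> snd e = i}" if "i \<in> R" for i
    using that by auto
  ultimately show ?thesis by simp
qed

lemma sum_outflow_eq:
  fixes Z :: "'a \<times> 'a \<Rightarrow> real"
  assumes "finite A" "finite R"
  shows "(\<Sum>i\<in>R. \<Sum>j | (i, j) \<in> A. Z (i, j)) = (\<Sum>e | e \<in> A \<and> fst e \<in> R. Z e)"
proof -
  \<comment> \<open>Outflow is inflow after reversing all arcs.\<close>
  have "(\<Sum>i\<in>R. \<Sum>j | (j, i) \<in> A\<inverse>. (Z \<circ> prod.swap) (j, i))
      = (\<Sum>e | e \<in> A\<inverse> \<and> snd e \<in> R. (Z \<circ> prod.swap) e)"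
    using assms by (intro sum_inflow_eq) auto
  also have "\<dots> = (\<Sum>e | e \<in> A \<and> fst e \<in> R. Z e)"
    by (rule sum.reindex_bij_witness[where i = prod.swap and j = prod.swap]) auto
  finally show ?thesis by simp
qed

text \<open>Otherwise the node constraints, summed over the set \<open>R\<close> of reachable nodes,
  force a net inflow of at most -1. But no flow leaves \<open>R\<close>, since every arc leaving it
  is closed, so the net inflow is nonnegative.\<close>

lemma SP_feasible_imp_reachable_facility:
  assumes fin: "finite N" and A: "A \<subseteq> N \<times> N"
    and W01: "\<forall>i\<in>N. W i t \<in> {0, 1}" and X01: "\<forall>e\<in>A. X e t \<in> {0, 1}"
    and k: "k \<in> N" "W k t = 0"
    and Z: "SP_feasible N A k t W X Z"
  shows "\<exists>j\<in>N - {k}. W j t = 1 \<and> k \<rightarrow>\<^sup>*\<^bsub>open_network N A t X\<^esub> j"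
proof (rule ccontr)
  assume no_facility: "\<not> ?thesis"
  interpret fin_digraph "open_network N A t X"
    by (rule fin_digraph_open_network) fact+
  define R where "R = {i. k \<rightarrow>\<^sup>*\<^bsub>open_network N A t X\<^esub> i}"
  have RN: "R \<subseteq> N"
    unfolding R_def using reachable_in_verts(2) by fastforce
  have kR: "k \<in> R" using k by (simp add: R_def)
  have finA: "finite A" and finR: "finite R"
    using fin A RN finite_subset by blast+
  have W0: "W i t = 0" if "i \<in> R" for i
    using no_facility that RN W01 k(2) unfolding R_def by blast
  let ?in = "\<lambda>i. \<Sum>j | (j, i) \<in> A. Z (j, i)" and ?out = "\<lambda>i. \<Sum>j | (i, j) \<in> A. Z (i, j)"
  have Zpos: "0 \<le> Z e" and Zle: "Z e \<le> X e t" if "e \<in> A" for e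
    using Z that by (auto simp: SP_feasible_def)
  have "?in k = 0"
    using Z by (intro sum.neutral) (auto simp: SP_feasible_def)
  moreover have "1 \<le> ?out k"
    using Z k(2) by (auto simp: SP_feasible_def)
  moreover have "?in i - ?out i \<le> 0" if "i \<in> R - {k}" for i
  proof -
    have "i \<in> N - {k}" "W i t = 0" using that RN W0 by auto
    then show ?thesis using Z unfolding SP_feasible_def by metis
  qed
  then have "(\<Sum>i\<in>R - {k}. ?in i - ?out i) \<le> 0"
    by (rule sum_nonpos)
  ultimately have "(\<Sum>i\<in>R. ?in i - ?out i) \<le> -1"
    by (subst sum.remove[OF finR kR]) linarith
  moreover have "(\<Sum>i\<in>R. ?in i - ?out i)
      = (\<Sum>e | e \<in> A \<and> snd e \<in> R. Z e) - (\<Sum>e | e \<in> A \<and> fst e \<in> R. Z e)"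
    using sum_inflow_eq[OF finA finR] sum_outflow_eq[OF finA finR] by (simp add: sum_subtractf)
  moreover have "(\<Sum>e | e \<in> A \<and> fst e \<in> R. Z e) = (\<Sum>e | e \<in> A \<and> fst e \<in> R \<and> snd e \<in> R. Z e)"
  proof (rule sum.mono_neutral_right)
    show "\<forall>e\<in>{e. e \<in> A \<and> fst e \<in> R} - {e. e \<in> A \<and> fst e \<in> R \<and> snd e \<in> R}. Z e = 0"
    proof
      fix e assume e: "e \<in> {e. e \<in> A \<and> fst e \<in> R} - {e. e \<in> A \<and> fst e \<in> R \<and> snd e \<in> R}"
      \<comment> \<open>An open arc starting in \<open>R\<close> would make its head reachable
        too.\<close>
      have "X e t \<noteq> 1"
      proof
        assume "X e t = 1"
        then have "arc e (fst e, snd e)" using e by (auto simp: arc_def)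
        then have "snd e \<in> R" using e reachable_arc_trans by (auto simp: R_def)
        then show False using e by blast
      qed
      moreover have "e \<in> A" using e by blast
      ultimately show "Z e = 0" using Zpos[of e] Zle[of e] X01 by force
    qed
  qed (use finA in auto)
  \<comment> \<open>Arcs entering \<open>R\<close> from outside can only add to the inflow.\<close>
  moreover have "(\<Sum>e | e \<in> A \<and> fst e \<in> R \<and> snd e \<in> R. Z e) \<le> (\<Sum>e | e \<in> A \<and> snd e \<in> R. Z e)"
    using finA Zpos by (intro sum_mono2) auto
  ultimately show False by simp
qed

text \<open>This is weak duality against the unit flow along \<open>p\<close>: the facility term is
  at least \<open>y j\<close>, and the arc term is at least the sum of \<open>l\<close> over
  \<open>p\<close>.\<close>

lemma dual_objective_le_apath_cost:
  assumes fin: "finite N" and A: "A \<subseteq> N \<times> N"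
    and W01: "\<forall>i\<in>N. W i t \<in> {0, 1}" and X01: "\<forall>e\<in>A. X e t \<in> {0, 1}"
    and j: "W j t = 1"
    and p: "pre_digraph.apath (open_network N A t X) k p j"
    and dual: "dual_feasible N A \<rho> k t y l"
  shows "dual_objective N A k t W X y l \<le> wf_digraph.awalk_cost (\<lambda>e. \<rho> e t) p"
proof -
  interpret fin_digraph "open_network N A t X"
    by (rule fin_digraph_open_network) fact+
  have finA: "finite A" using fin A finite_subset by blast
  have w: "awalk k p j" using p by (simp add: apath_def)
  then have jN: "j \<in> N" using awalk_last_in_verts by fastforce
  have sub: "e \<in> A \<and> X e t = 1" if "e \<in> set p" for e
    using w that by (auto simp: awalk_def)
  have dist: "distinct p"
    using p distinct_verts_imp_distinct by (auto simp: apath_def)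
  have "y (fst e) - y (snd e) \<le> \<rho> e t + l e" if "e \<in> set p" for e
    using dual sub[OF that] apath_head_neq_start[OF p that]
    by (cases e) (fastforce simp: dual_feasible_def)
  then have "y k - y j \<le> awalk_cost (\<lambda>e. \<rho> e t) p + sum_list (map l p)"
    by (intro potential_drop_le_awalk_cost[OF w]) auto
  \<comment> \<open>Distinctness turns the list sum into a set sum; the factor \<open>X e t\<close>
    is 1 on \<open>p\<close>.\<close>
  moreover have "sum_list (map l p) = (\<Sum>e\<in>set p. l e * X e t)"
    using dist sub by (simp add: sum_list_distinct_conv_sum_set)
  moreover have "\<dots> \<le> (\<Sum>e\<in>A. l e * X e t)"
    using dual X01 finA sub by (intro sum_mono2) (fastforce simp: dual_feasible_def)+
  moreover have "y j * W j t \<le> (\<Sum>i\<in>N. y i * W i t)"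
    using dual W01 fin jN by (intro member_le_sum) (fastforce simp: dual_feasible_def)+
  ultimately show ?thesis using j by (simp add: dual_objective_def)
qed

theorem theorem1:
  fixes N :: "'a set" and A :: "('a \<times> 'a) set" and n :: nat
    and \<rho> c :: "'a \<times> 'a \<Rightarrow> nat \<Rightarrow> real" and g :: "'a \<Rightarrow> nat \<Rightarrow> real"
    and Bfac Barc :: "nat \<Rightarrow> real"
    and W0 :: "'a \<Rightarrow> real" and X0 :: "'a \<times> 'a \<Rightarrow> real"
    and W U :: "'a \<Rightarrow> nat \<Rightarrow> real" and X V :: "'a \<times> 'a \<Rightarrow> nat \<Rightarrow> real"
    and k :: 'a and t :: nat
    and \<gamma> :: "'a \<Rightarrow> real" and l :: "'a \<times> 'a \<Rightarrow> real"
  defines "\<gamma> \<equiv> \<lambda>i. real_of_ereal (gamma_dist N A \<rho> k t W X i)"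
    and "l \<equiv> lambda_dist \<rho> t X \<gamma>"
  assumes "finite N" and "A \<subseteq> N \<times> N" and "\<forall>(i, j)\<in>A. (j, i) \<in> A"
    and "\<forall>e\<in>A. \<forall>s\<in>{1..n}. 0 \<le> \<rho> e s"
    and "\<forall>i\<in>N. \<forall>s\<in>{1..n}. 0 \<le> g i s"
    and "\<forall>e\<in>A. \<forall>s\<in>{1..n}. 0 \<le> c e s"
    and "\<forall>s\<in>{1..n}. 0 \<le> Bfac s \<and> 0 \<le> Barc s"
    and "\<forall>i\<in>N. W0 i \<in> {0, 1}" and "\<forall>e\<in>A. X0 e \<in> {0, 1}"
    and "master_solution N A n g c Bfac Barc W0 X0 W X U V"
    and "k \<in> N" and "t \<in> {1..n}"
    and "W k t = 0"
    and "\<exists>Z. SP_feasible N A k t W X Z"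
  shows "(\<forall>i\<in>N. \<bar>gamma_dist N A \<rho> k t W X i\<bar> \<noteq> \<infinity>) \<and> dual_optimal N A \<rho> k t W X \<gamma> l"
proof -
  let ?G = "open_network N A t X" and ?d = "source_dist N A \<rho> k t X"
    and ?s = "gamma_source N A \<rho> k t W X"
  interpret fin_digraph ?G
    by (rule fin_digraph_open_network) fact+
  have W01: "\<forall>i\<in>N. W i t \<in> {0, 1}" and X01: "\<forall>e\<in>A. X e t \<in> {0, 1}"
    using \<open>master_solution N A n g c Bfac Barc W0 X0 W X U V\<close> \<open>t \<in> {1..n}\<close>
    by (auto simp: master_solution_def)
  have cost: "0 \<le> \<rho> e t" if "e \<in> arcs ?G" for e
    using that assms(6) \<open>t \<in> {1..n}\<close> by auto
  have d_eq: "?d i = \<mu> (\<lambda>e. \<rho> e t) k i" for i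
    by (simp add: source_dist_def)
  have d_nonneg: "0 \<le> ?d i" for i
    unfolding d_eq using cost by (rule mu_nonneg)
  have d_k: "?d k = 0"
    unfolding d_eq using cost \<open>k \<in> N\<close> by (intro mu_self) auto
  have d_triangle: "?d j \<le> ?d i + \<rho> (i, j) t" if "(i, j) \<in> A" "X (i, j) t = 1" for i j
    unfolding d_eq using cost that by (intro pos_cost_mu_triangle) (auto simp: arc_to_ends_def)
  let ?F = "{j \<in> N - {k}. W j t = 1}"
  obtain Z where Z: "SP_feasible N A k t W X Z" using assms(16) by blast
  obtain r where r: "r \<in> ?F" "k \<rightarrow>\<^sup>*\<^bsub>?G\<^esub> r"
    using SP_feasible_imp_reachable_facility[OF \<open>finite N\<close> \<open>A \<subseteq> N \<times> N\<close> W01 X01 \<open>k \<in> N\<close> \<open>W k t = 0\<close> Z]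
    by blast
  have "?s \<in> ?d ` ?F"
    unfolding gamma_source_def using r \<open>finite N\<close> by (intro finite_INF_in) auto
  then obtain j where j: "j \<in> ?F" "?s = ?d j" by blast
  \<comment> \<open>The facility \<open>r\<close> need not be nearest; it only shows that the
    minimum is finite, which makes the minimiser \<open>j\<close> reachable.\<close>
  have "?s \<le> ?d r"
    unfolding gamma_source_def using r(1) by (rule INF_lower)
  also have "\<dots> < \<infinity>" unfolding d_eq using r(2) by (rule \<mu>_reach_conv[THEN iffD2])
  finally have "k \<rightarrow>\<^sup>*\<^bsub>?G\<^esub> j"
    unfolding j(2) d_eq by (rule \<mu>_reach_conv[THEN iffD1])
  then obtain p where p: "apath k p j" "?s = awalk_cost (\<lambda>e. \<rho> e t) p"
    using min_cost_awalk[of k j "\<lambda>e. \<rho> e t"] cost j(2) d_eq by auto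
  define s where "s = awalk_cost (\<lambda>e. \<rho> e t) p"
  have s: "?s = ereal s" using p(2) by (simp add: s_def)
  have s_nonneg: "0 \<le> s"
    using d_nonneg[of j] unfolding j(2)[symmetric] s by simp
  \<comment> \<open>The formula also covers \<open>k\<close>, because its distance is 0 and
    \<open>s\<close> is nonnegative.\<close>
  have gd: "gamma_dist N A \<rho> k t W X i = max 0 (ereal s - ?d i)" for i
    using s_nonneg by (simp add: gamma_dist_def s d_k max_def)
  \<comment> \<open>For an unreachable node the difference is minus infinity, so the maximum is 0.
    Hence all values are finite and \<open>real_of_ereal\<close> loses nothing.\<close>
  have gd_cases: "gamma_dist N A \<rho> k t W X i = ereal (\<gamma> i)
      \<and> 0 \<le> \<gamma> i \<and> (?d i = \<infinity> \<and> \<gamma> i = 0 \<or> (\<exists>x. ?d i = ereal x \<and> \<gamma> i = max 0 (s - x)))" for i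
    using d_nonneg[of i] by (cases "?d i") (auto simp: gd \<gamma>_def max_def)
  \<comment> \<open>Truncated subtraction from \<open>s\<close> is antitone and 1-Lipschitz in the
    distance. If \<open>b\<close> is unreachable, so is \<open>a\<close>, and both values are
    0.\<close>
  have \<gamma>_drop: "\<gamma> a - \<gamma> b \<le> \<rho> (a, b) t" if "(a, b) \<in> A" "X (a, b) t = 1" for a b
  proof -
    have "0 \<le> \<rho> (a, b) t" using cost that by simp
    then show ?thesis
      using d_triangle[OF that] gd_cases[of a] gd_cases[of b] by (auto simp: max_def)
  qed
  have feas: "dual_feasible N A \<rho> k t \<gamma> l"
    unfolding dual_feasible_def
  proof (intro conjI ballI)
    show "0 \<le> \<gamma> i" for i using gd_cases by blast
    show "0 \<le> l e" for e by (simp add: l_def lambda_dist_def)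
    fix e assume "e \<in> A"
    \<comment> \<open>On closed arcs \<open>l\<close> absorbs any excess drop; on open arcs there is
      none.\<close>
    then show "case e of (i, j) \<Rightarrow> j \<noteq> k \<longrightarrow> 0 \<le> \<rho> (i, j) t + l (i, j) + \<gamma> j - \<gamma> i"
      using X01 \<gamma>_drop by (cases e) (fastforce simp: l_def lambda_dist_def)
  qed
  have "\<gamma> k = s"
    using gd_cases[of k] s_nonneg by (auto simp: d_k zero_ereal_def)
  moreover have "(\<Sum>i\<in>N. \<gamma> i * W i t) = 0"
  proof (rule sum.neutral, rule ballI)
    fix i assume "i \<in> N"
    show "\<gamma> i * W i t = 0"
    \<comment> \<open>Open facilities lie at distance at least \<open>s\<close>, so \<gamma>
      vanishes there. The node \<open>k\<close> falls under the second case, where its closed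
      facility cancels the value \<open>s\<close>.\<close>
    proof (cases "i \<in> ?F")
      case True
      then have "ereal s \<le> ?d i" unfolding s[symmetric] gamma_source_def by (rule INF_lower)
      then have "\<gamma> i = 0" using gd_cases[of i] by auto
      then show ?thesis by simp
    next
      case False
      then show ?thesis using \<open>i \<in> N\<close> W01 \<open>W k t = 0\<close> by auto
    qed
  qed
  moreover have "(\<Sum>e\<in>A. l e * X e t) = 0"
    using X01 by (intro sum.neutral) (auto simp: l_def lambda_dist_def)
  ultimately have obj: "dual_objective N A k t W X \<gamma> l = s"
    by (simp add: dual_objective_def)
  have "dual_objective N A k t W X y l' \<le> s" if "dual_feasible N A \<rho> k t y l'" for y l'
    unfolding s_def using j(1) p(1) that W01 X01 \<open>finite N\<close> \<open>A \<subseteq> N \<times> N\<close>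
    by (intro dual_objective_le_apath_cost) auto
  then have "dual_optimal N A \<rho> k t W X \<gamma> l"
    using feas obj by (simp add: dual_optimal_def)
  moreover have "\<bar>gamma_dist N A \<rho> k t W X i\<bar> \<noteq> \<infinity>" for i
    using gd_cases[of i] by auto
  ultimately show ?thesis by simp
qed

end
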